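(* Let $\xi=(L^\xi,\Delta_0^\xi,B^\xi,d,G)$ be a generic configuration. There exists no $\xi$-Conventional axiom system $\alpha$ that can prove the validity of the translational reflection principle for any translation mapping $T$. In other words, for a $\xi$-Conventional axiom system $\alpha$ there is no algorithm $T$ that maps $\Pi_1^\xi$ sentences $\Psi$ onto alternate $\Pi_1^\xi$ sentences $\Psi^T$, with $\Psi^T$ equivalent to $\Psi$ in the Standard-M model, such that $\alpha$ can verify $$\forall p\ [\ \mathrm{Prf}_{\alpha,d}(\lceil\Psi\rceil,p)\Rightarrow\Psi^T\ ]$$ for every $\Pi_1^\xi$ sentence $\Psi$.
   Context: **Generic configurations.** Standard-M is the standard model of the natural numbers. A generic configuration $\xi$ is a 5-tuple $(L^\xi,\Delta_0^\xi,B^\xi,d,G)$ where: (1) $L^\xi$ is a language with symbols for $0,1,2,=,\le$ and $\mathrm{Maximum}(x,y)$, and enough function and constant symbols that every integer $k$ is the value of some term $T_k$. (2) $\Delta_0^\xi$ is a fixed class of fully bounded $L^\xi$-formulas (all quantifiers have the form $\exists v\le T$ or $\forall v\le T$ with $T$ a term), closed under negation, and rich enough to contain two formulas $\mathrm{Add}(x,y,z)$ and $\mathrm{Mult}(x,y,z)$ defining the graphs of addition and multiplication. Every $\Delta_0^\xi$ formula is both $\Pi_0^\xi$ and $\Sigma_0^\xi$; for $n\ge1$ a formula is $\Pi_n^\xi$ (resp. $\Sigma_n^\xi$) iff it can be written $\forall v_1\cdots\forall v_k\,\Phi$ with $\Phi\in\Sigma_{n-1}^\xi$ (resp. $\exists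 v_1\cdots\exists v_k\,\Phi$ with $\Phi\in\Pi_{n-1}^\xi$); $\Delta_0^\xi$ sentences count as both $\Pi_1^\xi$ and $\Sigma_1^\xi$. (3) $B^\xi$ (the base axiom system) is an axiom system whose axioms are true in Standard-M and which is $\Sigma_1^\xi$-complete: it proves every true $\Sigma_1^\xi$ sentence and refutes every false $\Pi_1^\xi$ sentence. (4) $d$ is a deduction method, conventional enough to satisfy the indirect-implication property associated with Gödel's Completeness Theorem: whether or not modus ponens is built in, whenever it can prove $X$, $Y$ and $(X\wedge Y)\to Z$, it can prove $Z$ (possibly by a much longer proof). (5) $G$ is a method for encoding the Gödel numbers of proofs. Proofs are identified with their Gödel numbers $p$. **$\xi$-Conventional systems.** An axiom system $\alpha$ is $\xi$-Conventional iff: (a) $\alpha$ is unable to verify (prove) its own consistency under $\xi$'s deduction method $d$; and (b) $\alpha$ is an extension of $B^\xi$ (hence it is $\Sigma_1^\xi$-complete: it proves every $\Sigma_1^\xi$ sentence true in Standard-M and refutes every false $\Pi_1^\xi$ sentence). **Notation.** $\lceil\Psi\rceil$ is the Gödel number of $\Psi$, and $\mathrm{Prf}_{\alpha,d}(t,p)$ is the formula stating that $p$ is a proof of $t$ from $\alpha$ using the deduction method $d$.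
   Formalization: The formal theorem additionally assumes that the class Δ0^ξ contains the atomic sentence 0=1, which expresses inconsistency; the listed conditions on ξ do not imply this, and without it the claim can fail. *)

theory Defs imports Main begin

datatype 'f trm = Var nat | App 'f "'f trm list"

datatype ('f, 'r) fm =
    Eq "'f trm" "'f trm"
  | Rel 'r "'f trm list"
  | Neg "('f, 'r) fm"
  | Conj "('f, 'r) fm" "('f, 'r) fm"
  | Disj "('f, 'r) fm" "('f, 'r) fm"
  | Imp "('f, 'r) fm" "('f, 'r) fm"
  | Forall nat "('f, 'r) fm"
  | Exists nat "('f, 'r) fm"

primrec vars_trm :: "'f trm \<Rightarrow> nat set" where
  "vars_trm (Var x) = {x}"
| "vars_trm (App f ts) = \<Union> (set (map vars_trm ts))"

primrec free_vars :: "('f, 'r) fm \<Rightarrow> nat set" where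
  "free_vars (Eq s t) = vars_trm s \<union> vars_trm t"
| "free_vars (Rel r ts) = \<Union> (vars_trm ` set ts)"
| "free_vars (Neg \<phi>) = free_vars \<phi>"
| "free_vars (Conj \<phi> \<psi>) = free_vars \<phi> \<union> free_vars \<psi>"
| "free_vars (Disj \<phi> \<psi>) = free_vars \<phi> \<union> free_vars \<psi>"
| "free_vars (Imp \<phi> \<psi>) = free_vars \<phi> \<union> free_vars \<psi>"
| "free_vars (Forall x \<phi>) = free_vars \<phi> - {x}"
| "free_vars (Exists x \<phi>) = free_vars \<phi> - {x}"

primrec subst_trm :: "nat \<Rightarrow> 'f trm \<Rightarrow> 'f trm \<Rightarrow> 'f trm" where
  "subst_trm x s (Var y) = (if y = x then s else Var y)"
| "subst_trm x s (App f ts) = App f (map (subst_trm x s) ts)"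

text \<open>Bound variables are not renamed: this is only used to substitute closed terms, where no
  capture can occur.\<close>

primrec subst :: "nat \<Rightarrow> 'f trm \<Rightarrow> ('f, 'r) fm \<Rightarrow> ('f, 'r) fm" where
  "subst x s (Eq t u) = Eq (subst_trm x s t) (subst_trm x s u)"
| "subst x s (Rel r ts) = Rel r (map (subst_trm x s) ts)"
| "subst x s (Neg \<phi>) = Neg (subst x s \<phi>)"
| "subst x s (Conj \<phi> \<psi>) = Conj (subst x s \<phi>) (subst x s \<psi>)"
| "subst x s (Disj \<phi> \<psi>) = Disj (subst x s \<phi>) (subst x s \<psi>)"
| "subst x s (Imp \<phi> \<psi>) = Imp (subst x s \<phi>) (subst x s \<psi>)"
| "subst x s (Forall y \<phi>) = Forall y (if y = x then \<phi> else subst x s \<phi>)"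
| "subst x s (Exists y \<phi>) = Exists y (if y = x then \<phi> else subst x s \<phi>)"

record ('f, 'r, 'u) struct =
  dom :: "'u set"
  fun_int :: "'f \<Rightarrow> 'u list \<Rightarrow> 'u"
  rel_int :: "'r \<Rightarrow> 'u list \<Rightarrow> bool"

primrec val :: "('f, 'r, 'u) struct \<Rightarrow> (nat \<Rightarrow> 'u) \<Rightarrow> 'f trm \<Rightarrow> 'u" where
  "val S e (Var x) = e x"
| "val S e (App f ts) = fun_int S f (map (val S e) ts)"

primrec sat :: "('f, 'r, 'u) struct \<Rightarrow> (nat \<Rightarrow> 'u) \<Rightarrow> ('f, 'r) fm \<Rightarrow> bool" where
  "sat S e (Eq s t) \<longleftrightarrow> val S e s = val S e t"
| "sat S e (Rel r ts) \<longleftrightarrow> rel_int S r (map (val S e) ts)"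
| "sat S e (Neg \<phi>) \<longleftrightarrow> \<not> sat S e \<phi>"
| "sat S e (Conj \<phi> \<psi>) \<longleftrightarrow> sat S e \<phi> \<and> sat S e \<psi>"
| "sat S e (Disj \<phi> \<psi>) \<longleftrightarrow> sat S e \<phi> \<or> sat S e \<psi>"
| "sat S e (Imp \<phi> \<psi>) \<longleftrightarrow> (sat S e \<phi> \<longrightarrow> sat S e \<psi>)"
| "sat S e (Forall x \<phi>) \<longleftrightarrow> (\<forall>u\<in>dom S. sat S (e(x := u)) \<phi>)"
| "sat S e (Exists x \<phi>) \<longleftrightarrow> (\<exists>u\<in>dom S. sat S (e(x := u)) \<phi>)"

definition true_in :: "('f, 'r, 'u) struct \<Rightarrow> ('f, 'r) fm \<Rightarrow> bool" where
  "true_in S \<phi> \<longleftrightarrow> (\<forall>e. range e \<subseteq> dom S \<longrightarrow> sat S e \<phi>)"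

text \<open>All elements of \<open>'f\<close> and \<open>'r\<close> are symbols of the language. As the language may contain
  arbitrary further symbols, it carries their interpretation in the standard model, as well as
  the choice of a closed term \<open>numeral_trm k\<close> denoting each natural number \<open>k\<close>.\<close>

record ('f, 'r) language =
  fun_arity :: "'f \<Rightarrow> nat"
  rel_arity :: "'r \<Rightarrow> nat"
  zero_sym :: 'f
  one_sym :: 'f
  two_sym :: 'f
  max_sym :: 'f
  le_sym :: 'r
  std_fun :: "'f \<Rightarrow> nat list \<Rightarrow> nat"
  std_rel :: "'r \<Rightarrow> nat list \<Rightarrow> bool"
  numeral_trm :: "nat \<Rightarrow> 'f trm"

definition standard_M :: "('f, 'r) language \<Rightarrow> ('f, 'r, nat) struct" where
  "standard_M L = \<lparr>dom = UNIV, fun_int = std_fun L, rel_int = std_rel L\<rparr>"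

primrec wf_trm :: "('f, 'r) language \<Rightarrow> 'f trm \<Rightarrow> bool" where
  "wf_trm L (Var x) \<longleftrightarrow> True"
| "wf_trm L (App f ts) \<longleftrightarrow> length ts = fun_arity L f \<and> list_all (\<lambda>b. b) (map (wf_trm L) ts)"

primrec wf_fm :: "('f, 'r) language \<Rightarrow> ('f, 'r) fm \<Rightarrow> bool" where
  "wf_fm L (Eq s t) \<longleftrightarrow> wf_trm L s \<and> wf_trm L t"
| "wf_fm L (Rel r ts) \<longleftrightarrow> length ts = rel_arity L r \<and> (\<forall>t\<in>set ts. wf_trm L t)"
| "wf_fm L (Neg \<phi>) \<longleftrightarrow> wf_fm L \<phi>"
| "wf_fm L (Conj \<phi> \<psi>) \<longleftrightarrow> wf_fm L \<phi> \<and> wf_fm L \<psi>"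
| "wf_fm L (Disj \<phi> \<psi>) \<longleftrightarrow> wf_fm L \<phi> \<and> wf_fm L \<psi>"
| "wf_fm L (Imp \<phi> \<psi>) \<longleftrightarrow> wf_fm L \<phi> \<and> wf_fm L \<psi>"
| "wf_fm L (Forall x \<phi>) \<longleftrightarrow> wf_fm L \<phi>"
| "wf_fm L (Exists x \<phi>) \<longleftrightarrow> wf_fm L \<phi>"

definition sentences :: "('f, 'r) language \<Rightarrow> ('f, 'r) fm set" where
  "sentences L = {\<phi>. wf_fm L \<phi> \<and> free_vars \<phi> = {}}"

definition zero_eq_one :: "('f, 'r) language \<Rightarrow> ('f, 'r) fm" where
  "zero_eq_one L = Eq (App (zero_sym L) []) (App (one_sym L) [])"

definition arithmetic_language :: "('f, 'r) language \<Rightarrow> bool" where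
  "arithmetic_language L \<longleftrightarrow>
     fun_arity L (zero_sym L) = 0 \<and> std_fun L (zero_sym L) [] = 0 \<and>
     fun_arity L (one_sym L) = 0 \<and> std_fun L (one_sym L) [] = 1 \<and>
     fun_arity L (two_sym L) = 0 \<and> std_fun L (two_sym L) [] = 2 \<and>
     fun_arity L (max_sym L) = 2 \<and> (\<forall>a b. std_fun L (max_sym L) [a, b] = max a b) \<and>
     rel_arity L (le_sym L) = 2 \<and> (\<forall>a b. std_rel L (le_sym L) [a, b] \<longleftrightarrow> a \<le> b) \<and>
     (\<forall>k. wf_trm L (numeral_trm L k) \<and> vars_trm (numeral_trm L k) = {} \<and>
          (\<forall>e. val (standard_M L) e (numeral_trm L k) = k))"

text \<open>\<open>\<forall>x\<le>t. \<phi>\<close> and \<open>\<exists>x\<le>t. \<phi>\<close> abbreviate \<open>\<forall>x. x \<le> t \<longrightarrow> \<phi>\<close> and \<open>\<exists>x. x \<le> t \<and> \<phi>\<close>, where \<open>x\<close>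
  does not occur in \<open>t\<close>.\<close>

inductive fully_bounded :: "('f, 'r) language \<Rightarrow> ('f, 'r) fm \<Rightarrow> bool" for L where
  "fully_bounded L (Eq s t)"
| "fully_bounded L (Rel r ts)"
| "fully_bounded L \<phi> \<Longrightarrow> fully_bounded L (Neg \<phi>)"
| "fully_bounded L \<phi> \<Longrightarrow> fully_bounded L \<psi> \<Longrightarrow> fully_bounded L (Conj \<phi> \<psi>)"
| "fully_bounded L \<phi> \<Longrightarrow> fully_bounded L \<psi> \<Longrightarrow> fully_bounded L (Disj \<phi> \<psi>)"
| "fully_bounded L \<phi> \<Longrightarrow> fully_bounded L \<psi> \<Longrightarrow> fully_bounded L (Imp \<phi> \<psi>)"
| "fully_bounded L \<phi> \<Longrightarrow> x \<notin> vars_trm t \<Longrightarrow>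
     fully_bounded L (Forall x (Imp (Rel (le_sym L) [Var x, t]) \<phi>))"
| "fully_bounded L \<phi> \<Longrightarrow> x \<notin> vars_trm t \<Longrightarrow>
     fully_bounded L (Exists x (Conj (Rel (le_sym L) [Var x, t]) \<phi>))"

definition defines_graph ::
  "('f, 'r) language \<Rightarrow> ('f, 'r) fm \<Rightarrow> (nat \<Rightarrow> nat \<Rightarrow> nat) \<Rightarrow> bool" where
  "defines_graph L \<phi> op \<longleftrightarrow>
     (\<exists>x y z. distinct [x, y, z] \<and> free_vars \<phi> \<subseteq> {x, y, z} \<and>
       (\<forall>e. sat (standard_M L) e \<phi> \<longleftrightarrow> op (e x) (e y) = e z))"

text \<open>The last clause concerns the sentence used below to express consistency. It is an atomic
  sentence, so it belongs to every customary class of bounded formulas, but it is not implied by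
  the other clauses.\<close>

definition delta0_class :: "('f, 'r) language \<Rightarrow> ('f, 'r) fm set \<Rightarrow> bool" where
  "delta0_class L D \<longleftrightarrow>
     (\<forall>\<phi>\<in>D. wf_fm L \<phi> \<and> fully_bounded L \<phi>) \<and>
     (\<forall>\<phi>\<in>D. Neg \<phi> \<in> D) \<and>
     (\<exists>Add\<in>D. defines_graph L Add (+)) \<and>
     (\<exists>Mult\<in>D. defines_graph L Mult (*)) \<and>
     zero_eq_one L \<in> D"

text \<open>The quantifier block may be empty, so that \<open>D\<close> is included in both classes on every
  level.\<close>

fun Pi_class Sigma_class :: "('f, 'r) fm set \<Rightarrow> nat \<Rightarrow> ('f, 'r) fm set" where
  "Pi_class D 0 = D"
| "Pi_class D (Suc n) = {foldr Forall vs \<phi> | vs \<phi>. \<phi> \<in> Sigma_class D n}"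
| "Sigma_class D 0 = D"
| "Sigma_class D (Suc n) = {foldr Exists vs \<phi> | vs \<phi>. \<phi> \<in> Pi_class D n}"

text \<open>Structures for a language. The carrier is a subset of \<open>nat\<close>; by the Loewenheim-Skolem
  theorem this is no restriction for logical consequence in the countable languages considered
  here (formulas have Goedel numbers).\<close>

definition structures :: "('f, 'r) language \<Rightarrow> ('f, 'r, nat) struct set" where
  "structures L = {S. dom S \<noteq> {} \<and>
     (\<forall>f us. length us = fun_arity L f \<and> set us \<subseteq> dom S \<longrightarrow> fun_int S f us \<in> dom S)}"

definition entails :: "('f, 'r) language \<Rightarrow> ('f, 'r) fm set \<Rightarrow> ('f, 'r) fm \<Rightarrow> bool" where
  "entails L A \<phi> \<longleftrightarrow>
     (\<forall>S\<in>structures L. (\<forall>\<psi>\<in>A. true_in S \<psi>) \<longrightarrow> true_in S \<phi>)"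

text \<open>\<open>d A \<phi> \<pi>\<close> means that \<open>\<pi>\<close> is a proof of \<open>\<phi>\<close> from the axiom system \<open>A\<close>.\<close>

type_synonym ('f, 'r, 'p) deduction = "('f, 'r) fm set \<Rightarrow> ('f, 'r) fm \<Rightarrow> 'p \<Rightarrow> bool"

definition proves ::
  "('f, 'r, 'p) deduction \<Rightarrow> ('f, 'r) fm set \<Rightarrow> ('f, 'r) fm \<Rightarrow> bool" where
  "proves d A \<phi> \<longleftrightarrow> (\<exists>\<pi>. d A \<phi> \<pi>)"

definition indirect_implication ::
  "('f, 'r) language \<Rightarrow> ('f, 'r, 'p) deduction \<Rightarrow> bool" where
  "indirect_implication L d \<longleftrightarrow>
     (\<forall>A X Y Z. A \<subseteq> sentences L \<and> X \<in> sentences L \<and> Y \<in> sentences L \<and> Z \<in> sentences L \<and>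
        proves d A X \<and> proves d A Y \<and> proves d A (Imp (Conj X Y) Z) \<longrightarrow> proves d A Z)"

text \<open>Besides the indirect-implication property, a deduction method for first-order logic is
  sound, can prove every axiom and, as in Goedel's Completeness Theorem, every logically valid
  sentence. By compactness these clauses together say that provability is logical consequence.\<close>

definition deduction_method ::
  "('f, 'r) language \<Rightarrow> ('f, 'r, 'p) deduction \<Rightarrow> bool" where
  "deduction_method L d \<longleftrightarrow>
     (\<forall>A \<phi>. A \<subseteq> sentences L \<and> \<phi> \<in> sentences L \<and> proves d A \<phi> \<longrightarrow> entails L A \<phi>) \<and>
     (\<forall>A. A \<subseteq> sentences L \<longrightarrow> (\<forall>\<phi>\<in>A. proves d A \<phi>)) \<and>
     (\<forall>A. A \<subseteq> sentences L \<longrightarrow> (\<forall>\<phi>\<in>sentences L. entails L {} \<phi> \<longrightarrow> proves d A \<phi>)) \<and>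
     indirect_implication L d"

text \<open>A configuration is a 5-tuple, to which the Goedel numbering of formulas is added.\<close>

record ('f, 'r, 'p) config =
  lang :: "('f, 'r) language"
  delta0 :: "('f, 'r) fm set"
  base :: "('f, 'r) fm set"
  ded :: "('f, 'r, 'p) deduction"
  gn_proof :: "'p \<Rightarrow> nat"
  gn :: "('f, 'r) fm \<Rightarrow> nat"

definition Pi1_sentences :: "('f, 'r, 'p) config \<Rightarrow> ('f, 'r) fm set" where
  "Pi1_sentences \<xi> = Pi_class (delta0 \<xi>) 1 \<inter> sentences (lang \<xi>)"

definition Sigma1_sentences :: "('f, 'r, 'p) config \<Rightarrow> ('f, 'r) fm set" where
  "Sigma1_sentences \<xi> = Sigma_class (delta0 \<xi>) 1 \<inter> sentences (lang \<xi>)"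

abbreviation true_std :: "('f, 'r, 'p) config \<Rightarrow> ('f, 'r) fm \<Rightarrow> bool" where
  "true_std \<xi> \<equiv> true_in (standard_M (lang \<xi>))"

abbreviation provable :: "('f, 'r, 'p) config \<Rightarrow> ('f, 'r) fm set \<Rightarrow> ('f, 'r) fm \<Rightarrow> bool" where
  "provable \<xi> \<equiv> proves (ded \<xi>)"

definition Sigma1_complete :: "('f, 'r, 'p) config \<Rightarrow> ('f, 'r) fm set \<Rightarrow> bool" where
  "Sigma1_complete \<xi> A \<longleftrightarrow>
     (\<forall>\<phi>\<in>Sigma1_sentences \<xi>. true_std \<xi> \<phi> \<longrightarrow> provable \<xi> A \<phi>) \<and>
     (\<forall>\<phi>\<in>Pi1_sentences \<xi>. \<not> true_std \<xi> \<phi> \<longrightarrow> provable \<xi> A (Neg \<phi>))"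

definition generic_configuration :: "('f, 'r, 'p) config \<Rightarrow> bool" where
  "generic_configuration \<xi> \<longleftrightarrow>
     arithmetic_language (lang \<xi>) \<and>
     delta0_class (lang \<xi>) (delta0 \<xi>) \<and>
     base \<xi> \<subseteq> sentences (lang \<xi>) \<and> (\<forall>\<phi>\<in>base \<xi>. true_std \<xi> \<phi>) \<and> Sigma1_complete \<xi> (base \<xi>) \<and>
     deduction_method (lang \<xi>) (ded \<xi>) \<and>
     inj (gn_proof \<xi>) \<and>
     inj_on (gn \<xi>) {\<phi>. wf_fm (lang \<xi>) \<phi>}"

text \<open>\<open>Prf\<close> is a formula with free variables \<open>Var 0\<close> (for \<open>t\<close>) and \<open>Var 1\<close> (for \<open>p\<close>) which says, in
  the standard model, that \<open>p\<close> is (the Goedel number of) a proof of \<open>t\<close> from \<open>\<alpha>\<close>. Nothing is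
  assumed about which of the possible arithmetizations it is.\<close>

definition proof_predicate ::
  "('f, 'r, 'p) config \<Rightarrow> ('f, 'r) fm set \<Rightarrow> ('f, 'r) fm \<Rightarrow> bool" where
  "proof_predicate \<xi> \<alpha> Prf \<longleftrightarrow>
     wf_fm (lang \<xi>) Prf \<and> free_vars Prf \<subseteq> {0, 1} \<and>
     (\<forall>e. sat (standard_M (lang \<xi>)) e Prf \<longleftrightarrow>
       (\<exists>\<phi>\<in>sentences (lang \<xi>). \<exists>\<pi>. e 0 = gn \<xi> \<phi> \<and> e 1 = gn_proof \<xi> \<pi> \<and> ded \<xi> \<alpha> \<phi> \<pi>))"

definition Prf_of :: "('f, 'r, 'p) config \<Rightarrow> ('f, 'r) fm \<Rightarrow> ('f, 'r) fm \<Rightarrow> ('f, 'r) fm" where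
  "Prf_of \<xi> Prf \<Psi> = subst 0 (numeral_trm (lang \<xi>) (gn \<xi> \<Psi>)) Prf"

definition consistency_statement :: "('f, 'r, 'p) config \<Rightarrow> ('f, 'r) fm \<Rightarrow> ('f, 'r) fm" where
  "consistency_statement \<xi> Prf = Forall 1 (Neg (Prf_of \<xi> Prf (zero_eq_one (lang \<xi>))))"

text \<open>Being an extension is a relation between theories: every theorem of the base system is a
  theorem of \<open>\<alpha>\<close>. In particular \<open>\<alpha>\<close> may contain the base axioms.\<close>

definition conventional ::
  "('f, 'r, 'p) config \<Rightarrow> ('f, 'r) fm \<Rightarrow> ('f, 'r) fm set \<Rightarrow> bool" where
  "conventional \<xi> Prf \<alpha> \<longleftrightarrow>
     \<alpha> \<subseteq> sentences (lang \<xi>) \<and>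
     \<not> provable \<xi> \<alpha> (consistency_statement \<xi> Prf) \<and>
     (\<forall>\<phi>\<in>sentences (lang \<xi>). provable \<xi> (base \<xi>) \<phi> \<longrightarrow> provable \<xi> \<alpha> \<phi>)"

text \<open>Partial recursive functions. \<open>computes f xs y\<close> means that \<open>f\<close> halts on the arguments
  \<open>xs\<close> with result \<open>y\<close>.\<close>

datatype recf = Zero | Succ | Proj nat | Comp recf "recf list" | PrimRec recf recf | Mu recf

inductive computes :: "recf \<Rightarrow> nat list \<Rightarrow> nat \<Rightarrow> bool" where
  "computes Zero xs 0"
| "computes Succ [x] (Suc x)"
| "i < length xs \<Longrightarrow> computes (Proj i) xs (xs ! i)"
| "list_all2 (\<lambda>g y. computes g xs y) gs ys \<Longrightarrow> computes f ys z \<Longrightarrow> computes (Comp f gs) xs z"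
| "computes f xs y \<Longrightarrow> computes (PrimRec f g) (0 # xs) y"
| "computes (PrimRec f g) (n # xs) y \<Longrightarrow> computes g (n # y # xs) z \<Longrightarrow>
     computes (PrimRec f g) (Suc n # xs) z"
| "computes f (n # xs) 0 \<Longrightarrow> \<forall>m<n. \<exists>k. computes f (m # xs) (Suc k) \<Longrightarrow> computes (Mu f) xs n"

definition translation_algorithm ::
  "('f, 'r, 'p) config \<Rightarrow> (('f, 'r) fm \<Rightarrow> ('f, 'r) fm) \<Rightarrow> bool" where
  "translation_algorithm \<xi> T \<longleftrightarrow>
     (\<forall>\<Psi>\<in>Pi1_sentences \<xi>. T \<Psi> \<in> Pi1_sentences \<xi> \<and> (true_std \<xi> (T \<Psi>) \<longleftrightarrow> true_std \<xi> \<Psi>)) \<and>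
     (\<exists>f. \<forall>\<Psi>\<in>Pi1_sentences \<xi>. computes f [gn \<xi> \<Psi>] (gn \<xi> (T \<Psi>)))"

definition translational_reflection ::
  "('f, 'r, 'p) config \<Rightarrow> ('f, 'r) fm \<Rightarrow> (('f, 'r) fm \<Rightarrow> ('f, 'r) fm) \<Rightarrow> ('f, 'r) fm \<Rightarrow> ('f, 'r) fm"
  where
  "translational_reflection \<xi> Prf T \<Psi> = Forall 1 (Imp (Prf_of \<xi> Prf \<Psi>) (T \<Psi>))"

end

(* Apply reflection to the sentence 0 = 1. Its translation is again a false Pi_1 sentence, so the
   base system refutes it; together with the reflection principle for 0 = 1 this refutation
   logically implies consistency, which a conventional system cannot prove. *)

theory Submission imports Defs begin

lemma wf_subst_trm: "wf_trm L t \<Longrightarrow> wf_trm L s \<Longrightarrow> wf_trm L (subst_trm x s t)"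
  by (induction t) (auto simp: list_all_iff)

lemma wf_subst: "wf_fm L \<phi> \<Longrightarrow> wf_trm L s \<Longrightarrow> wf_fm L (subst x s \<phi>)"
  by (induction \<phi>) (auto simp: wf_subst_trm)

lemma vars_subst_trm: "vars_trm s = {} \<Longrightarrow> vars_trm (subst_trm x s t) = vars_trm t - {x}"
  by (induction t) auto

text \<open>A closed \<open>s\<close> brings in no variables. Substitution stops at a quantifier
  over \<open>x\<close>, but \<open>x\<close> is not free there anyway.\<close>

lemma free_vars_subst: "vars_trm s = {} \<Longrightarrow> free_vars (subst x s \<phi>) = free_vars \<phi> - {x}"
  by (induction \<phi>) (auto simp: vars_subst_trm)

lemma val_cong: "(\<And>x. x \<in> vars_trm t \<Longrightarrow> e x = e' x) \<Longrightarrow> val S e t = val S e' t"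
proof (induction t)
  case (App f ts)
  then have "map (val S e) ts = map (val S e') ts"
    by (intro map_cong refl) auto
  then show ?case
    by (simp only: val.simps)
qed simp

text \<open>Coincidence lemma, needed to move a closed formula past a quantifier. Both assignments
  stay arbitrary because the quantifier cases use the hypothesis for updated ones.\<close>

lemma sat_cong: "(\<And>x. x \<in> free_vars \<phi> \<Longrightarrow> e x = e' x) \<Longrightarrow> sat S e \<phi> \<longleftrightarrow> sat S e' \<phi>"
proof (induction \<phi> arbitrary: e e')
  case (Eq s t)
  then have "val S e s = val S e' s" "val S e t = val S e' t"
    by (auto intro!: val_cong)
  then show ?case
    by simp
next
  case (Rel r ts)
  then have "map (val S e) ts = map (val S e') ts"
    by (intro map_cong refl val_cong) auto
  then show ?case
    by (simp only: sat.simps)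
next
  case (Neg \<phi>)
  from Neg.IH[of e e'] Neg.prems show ?case by simp
next
  case (Conj \<phi> \<psi>)
  from Conj.IH(1)[of e e'] Conj.IH(2)[of e e'] Conj.prems show ?case by simp
next
  case (Disj \<phi> \<psi>)
  from Disj.IH(1)[of e e'] Disj.IH(2)[of e e'] Disj.prems show ?case by simp
next
  case (Imp \<phi> \<psi>)
  from Imp.IH(1)[of e e'] Imp.IH(2)[of e e'] Imp.prems show ?case by simp
next
  case (Forall y \<phi>)
  have "sat S (e(y := u)) \<phi> \<longleftrightarrow> sat S (e'(y := u)) \<phi>" for u
    using Forall.prems by (intro Forall.IH) auto
  then show ?case
    by simp
next
  case (Exists y \<phi>)
  have "sat S (e(y := u)) \<phi> \<longleftrightarrow> sat S (e'(y := u)) \<phi>" for u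
    using Exists.prems by (intro Exists.IH) auto
  then show ?case
    by simp
qed

text \<open>The truth value of the closed \<open>\<psi>\<close> does not depend on the value of
  \<open>x\<close>, so any value satisfying \<open>\<phi>\<close> would make \<open>\<psi>\<close>
  true, against \<open>Neg \<psi>\<close>.\<close>

lemma entails_Forall_Neg:
  assumes "free_vars \<psi> = {}"
  shows "entails L A (Imp (Conj (Forall x (Imp \<phi> \<psi>)) (Neg \<psi>)) (Forall x (Neg \<phi>)))"
proof -
  have "sat S (e(x := u)) \<psi> \<longleftrightarrow> sat S e \<psi>" for S :: "('a, 'b, nat) struct" and e u
    using assms by (intro sat_cong) simp
  then show ?thesis
    by (auto simp: entails_def true_in_def)
qed

text \<open>A closed numeral replaces variable 0, which leaves only the proof variable 1.
  Quantifying over it therefore yields sentences.\<close>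

lemma Prf_of_wf_free_vars:
  assumes "generic_configuration \<xi>" and "proof_predicate \<xi> \<alpha> Prf"
  shows "wf_fm (lang \<xi>) (Prf_of \<xi> Prf \<Psi>)" and "free_vars (Prf_of \<xi> Prf \<Psi>) \<subseteq> {1}"
  using assms
  by (auto simp: generic_configuration_def arithmetic_language_def proof_predicate_def
      Prf_of_def wf_subst free_vars_subst)

lemma zero_eq_one_Pi1:
  assumes "generic_configuration \<xi>"
  shows "zero_eq_one (lang \<xi>) \<in> Pi1_sentences \<xi>"
proof -
  let ?\<Psi> = "zero_eq_one (lang \<xi>)"
  have "?\<Psi> \<in> sentences (lang \<xi>)"
    using assms
    by (simp add: generic_configuration_def arithmetic_language_def zero_eq_one_def sentences_def)
  \<comment> \<open>The empty quantifier block lifts a \<Delta>0 formula to \<Pi>1.\<close>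
  moreover have "?\<Psi> = foldr Forall [] ?\<Psi>" and "?\<Psi> \<in> Sigma_class (delta0 \<xi>) 0"
    using assms by (simp_all add: generic_configuration_def delta0_class_def)
  then have "?\<Psi> \<in> Pi_class (delta0 \<xi>) 1"
    unfolding One_nat_def Pi_class.simps by blast
  ultimately show ?thesis
    by (simp add: Pi1_sentences_def)
qed

lemma zero_eq_one_false:
  assumes "generic_configuration \<xi>"
  shows "\<not> true_std \<xi> (zero_eq_one (lang \<xi>))"
  using assms
  by (simp add: generic_configuration_def arithmetic_language_def zero_eq_one_def true_in_def
      standard_M_def)

theorem theoremE1:
  fixes \<xi> :: "('f, 'r, 'p) config"
    and \<alpha> :: "('f, 'r) fm set"
    and Prf :: "('f, 'r) fm"
  assumes "generic_configuration \<xi>"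
    and "proof_predicate \<xi> \<alpha> Prf"
    and "conventional \<xi> Prf \<alpha>"
  shows "\<not> (\<exists>T. translation_algorithm \<xi> T \<and>
              (\<forall>\<Psi>\<in>Pi1_sentences \<xi>. provable \<xi> \<alpha> (translational_reflection \<xi> Prf T \<Psi>)))"
proof
  let ?L = "lang \<xi>"
  let ?\<Psi> = "zero_eq_one ?L"
  assume "\<exists>T. translation_algorithm \<xi> T \<and>
              (\<forall>\<Psi>\<in>Pi1_sentences \<xi>. provable \<xi> \<alpha> (translational_reflection \<xi> Prf T \<Psi>))"
  then obtain T where T: "translation_algorithm \<xi> T"
    and refl: "\<And>\<Psi>. \<Psi> \<in> Pi1_sentences \<xi> \<Longrightarrow>
                 provable \<xi> \<alpha> (translational_reflection \<xi> Prf T \<Psi>)"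
    by blast
  let ?X = "translational_reflection \<xi> Prf T ?\<Psi>"
  let ?Y = "Neg (T ?\<Psi>)"
  let ?Z = "consistency_statement \<xi> Prf"
  have T\<Psi>: "T ?\<Psi> \<in> Pi1_sentences \<xi>" "\<not> true_std \<xi> (T ?\<Psi>)"
    using T zero_eq_one_Pi1 zero_eq_one_false assms(1)
    unfolding translation_algorithm_def by blast+
  then have wf: "wf_fm ?L (T ?\<Psi>)" "free_vars (T ?\<Psi>) = {}"
    by (auto simp: Pi1_sentences_def sentences_def)
  have sentences: "?X \<in> sentences ?L" "?Y \<in> sentences ?L" "?Z \<in> sentences ?L"
    using wf Prf_of_wf_free_vars[OF assms(1,2), of ?\<Psi>]
    by (auto simp: sentences_def translational_reflection_def consistency_statement_def)
  have \<alpha>: "\<alpha> \<subseteq> sentences ?L"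
    using assms(3) by (simp add: conventional_def)
  \<comment> \<open>The refutation half of \<open>Sigma1_complete\<close>, applied to the false
    \<Pi>1 sentence \<open>T ?\<Psi>\<close>.\<close>
  have "provable \<xi> (base \<xi>) ?Y"
    using assms(1) T\<Psi> by (auto simp: generic_configuration_def Sigma1_complete_def)
  then have Y: "provable \<xi> \<alpha> ?Y"
    using assms(3) sentences(2) by (auto simp: conventional_def)
  have d: "deduction_method ?L (ded \<xi>)"
    using assms(1) by (simp add: generic_configuration_def)
  \<comment> \<open>Here \<open>\<phi>\<close> says that variable 1 is a proof of 0 = 1, and
    \<open>\<psi>\<close> is the translation of 0 = 1.\<close>
  have "entails ?L {} (Imp (Conj ?X ?Y) ?Z)"
    unfolding translational_reflection_def consistency_statement_def
    using wf(2) by (rule entails_Forall_Neg)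
  moreover have "Imp (Conj ?X ?Y) ?Z \<in> sentences ?L"
    using sentences by (simp add: sentences_def)
  \<comment> \<open>Every logically valid sentence is provable from \<open>\<alpha>\<close>, by the
    completeness clause of \<open>deduction_method\<close>.\<close>
  ultimately have "provable \<xi> \<alpha> (Imp (Conj ?X ?Y) ?Z)"
    using d \<alpha> unfolding deduction_method_def by blast
  \<comment> \<open>The indirect-implication property takes the place of modus ponens, which
    \<open>d\<close> may lack as a rule.\<close>
  then have "provable \<xi> \<alpha> ?Z"
    using d \<alpha> sentences Y refl[OF zero_eq_one_Pi1[OF assms(1)]]
    unfolding deduction_method_def indirect_implication_def by blast
  then show False
    using assms(3) by (simp add: conventional_def)
qed

end
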